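(* Let $(A,\to,\rightsquigarrow,1,\exists,\forall)$ be a monadic pseudo BE-algebra whose relation $\le$ is transitive (that is, a monadic pseudo BE(T)-algebra). Then $(\exists,\forall)$ is a residuated pair over $A$: the maps $\exists$ and $\forall$ are isotone with respect to $\le$, and for all $x,y\in A$, $$\exists x\le y \iff x\le \forall y.$$
   Context: A pseudo BE-algebra is an algebra $(A,\to,\rightsquigarrow,1)$ of type $(2,2,0)$ such that for all $x,y,z\in A$: $x\to x=x\rightsquigarrow x=1$; $x\to 1=x\rightsquigarrow 1=1$; $1\to x=1\rightsquigarrow x=x$; $x\to(y\rightsquigarrow z)=y\rightsquigarrow(x\to z)$; and $x\to y=1$ iff $x\rightsquigarrow y=1$. One writes $x\le y$ iff $x\to y=1$ (equivalently $x\rightsquigarrow y=1$); this relation need not be antisymmetric or transitive in general. A pseudo BE(T)-algebra is a pseudo BE-algebra in which $\le$ is transitive. A monadic pseudo BE-algebra is a pseudo BE-algebra $A$ with maps $\exists,\forall:A\to A$ such that for all $x,y\in A$: (M1) $x\to\exists x=x\rightsquigarrow\exists x=1$; (M2) $\forall x\to x=\forall x\rightsquigarrow x=1$; (M3) $\forall(x\to\exists y)=\exists x\to\exists y$ and $\forall(x\rightsquigarrow\exists y)=\exists x\rightsquigarrow\exists y$; (M4) $\forall(\exists x\to y)=\exists x\to\forall y$ and $\forall(\exists x\rightsquigarrow y)=\exists x\rightsquigarrow\forall y$; (M5) $\exists\forall x=\forall x$. A map $f:A\to A$ is isotone if $x\le y$ implies $f(x)\le f(y)$. *)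

theory Defs
  imports Main
begin

locale pseudo_BE =
  fixes imp :: "'a \<Rightarrow> 'a \<Rightarrow> 'a"  (infixr \<open>\<rightarrow>\<close> 65)
    and rimp :: "'a \<Rightarrow> 'a \<Rightarrow> 'a"  (infixr \<open>\<leadsto>\<close> 65)
    and one :: 'a  (\<open>\<one>\<close>)
  assumes self: "x \<rightarrow> x = \<one>" "x \<leadsto> x = \<one>"
    and to_one: "x \<rightarrow> \<one> = \<one>" "x \<leadsto> \<one> = \<one>"
    and from_one: "\<one> \<rightarrow> x = x" "\<one> \<leadsto> x = x"
    and exchange: "x \<rightarrow> (y \<leadsto> z) = y \<leadsto> (x \<rightarrow> z)"
    and imp_one_iff: "x \<rightarrow> y = \<one> \<longleftrightarrow> x \<leadsto> y = \<one>"
begin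

definition le :: "'a \<Rightarrow> 'a \<Rightarrow> bool"  (infix \<open>\<preceq>\<close> 50)
  where "x \<preceq> y \<longleftrightarrow> x \<rightarrow> y = \<one>"

end

locale monadic_pseudo_BE = pseudo_BE +
  fixes E :: "'a \<Rightarrow> 'a"
    and U :: "'a \<Rightarrow> 'a"
  assumes M1: "x \<rightarrow> E x = \<one>" "x \<leadsto> E x = \<one>"
    and M2: "U x \<rightarrow> x = \<one>" "U x \<leadsto> x = \<one>"
    and M3: "U (x \<rightarrow> E y) = E x \<rightarrow> E y" "U (x \<leadsto> E y) = E x \<leadsto> E y"
    and M4: "U (E x \<rightarrow> y) = E x \<rightarrow> U y" "U (E x \<leadsto> y) = E x \<leadsto> U y"
    and M5: "E (U x) = U x"

locale pseudo_BE_T = pseudo_BE +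
  assumes le_trans: "transp le"

locale monadic_pseudo_BE_T = monadic_pseudo_BE + pseudo_BE_T

text \<open>The relation need not be antisymmetric, so the library's notions of Galois connection,
  which are based on partial orders, do not apply.\<close>

definition residuated_pair :: "('a \<Rightarrow> 'a \<Rightarrow> bool) \<Rightarrow> ('a \<Rightarrow> 'a) \<Rightarrow> ('a \<Rightarrow> 'a) \<Rightarrow> bool"
  where "residuated_pair R f g \<longleftrightarrow>
    monotone R R f \<and> monotone R R g \<and> (\<forall>x y. R (f x) y \<longleftrightarrow> R x (g y))"

end

theory Submission
  imports Defs
begin

text \<open>The range of \<open>E\<close> consists of the elements that both quantifiers fix, and
  every \<open>U y\<close> lies in it by M5. Since \<open>U \<one> = \<one>\<close>, applying \<open>U\<close> to an equation
  \<open>x \<rightarrow> E y = \<one>\<close> or \<open>E x \<rightarrow> y = \<one>\<close> turns M3 and M4 into order statements: an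
  element of the range that lies above \<open>x\<close> also lies above \<open>E x\<close>, and one that lies below \<open>y\<close>
  also lies below \<open>U y\<close>. So \<open>E x\<close> is a least element of the range above \<open>x\<close> and \<open>U y\<close> a
  greatest one below \<open>y\<close>. Adjointness and isotonicity follow by composing this with
  \<open>x \<preceq> E x\<close> and \<open>U y \<preceq> y\<close> by transitivity.\<close>

context monadic_pseudo_BE
begin

text \<open>By M1 and M3, \<open>U \<one> = U (x \<rightarrow> E x) = E x \<rightarrow> E x\<close>, for an arbitrary \<open>x\<close>.\<close>

lemma U_one: "U \<one> = \<one>"
  using M3(1)[of one one] by (simp add: M1 self)

lemma le_E: "x \<preceq> E x"
  by (simp add: le_def M1)

lemma U_le: "U x \<preceq> x"
  by (simp add: le_def M2)

lemma E_least: "x \<preceq> E y \<Longrightarrow> E x \<preceq> E y"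
  by (metis M3(1) U_one le_def)

lemma U_greatest: "E x \<preceq> y \<Longrightarrow> E x \<preceq> U y"
  by (metis M4(1) U_one le_def)

end

context monadic_pseudo_BE_T
begin

lemma trans_le: "x \<preceq> y \<Longrightarrow> y \<preceq> z \<Longrightarrow> x \<preceq> z"
  using le_trans by (rule transpD)

lemma E_le_iff_le_U: "E x \<preceq> y \<longleftrightarrow> x \<preceq> U y"
proof
  assume "E x \<preceq> y"
  then show "x \<preceq> U y"
    by (rule trans_le[OF le_E U_greatest])
next
  assume "x \<preceq> U y"
  then have "E x \<preceq> U y"
    using E_least[of x "U y"] by (simp add: M5)
  then show "E x \<preceq> y"
    by (rule trans_le[OF _ U_le])
qed

lemma E_isotone: "x \<preceq> y \<Longrightarrow> E x \<preceq> E y"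
  by (rule E_least[OF trans_le[OF _ le_E]])

lemma U_isotone: "x \<preceq> y \<Longrightarrow> U x \<preceq> U y"
  using U_greatest[of "U x" y] trans_le[OF U_le] by (simp add: M5)

lemma residuated_pair_E_U: "residuated_pair (\<preceq>) E U"
  unfolding residuated_pair_def
  by (auto intro!: monotoneI E_isotone U_isotone simp: E_le_iff_le_U)

end

theorem mainTheorem1:
  fixes imp rimp :: "'a \<Rightarrow> 'a \<Rightarrow> 'a"
    and one :: 'a
    and E U :: "'a \<Rightarrow> 'a"
  assumes "monadic_pseudo_BE_T imp rimp one E U"
  shows "residuated_pair (pseudo_BE.le imp one) E U"
  using assms by (rule monadic_pseudo_BE_T.residuated_pair_E_U)

end
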